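(* Let $n,m,\ell$ be integers with $1\leq \ell+1\leq m\leq n$. Let $X_1,X_2,\ldots,X_n$ be i.i.d. Poisson random variables with parameter $\lambda>0$. Then the maximal correlation coefficient of the two minima is $$R\left(\min_{i:1\leq i\leq m}X_i,\ \min_{j:\ell+1\leq j\leq n}X_j\right)=R_{m,\ell}\bigl(1-e^{-\lambda}\bigr),$$ where, for $q\in(0,1)$, $$R_{m,\ell}(q):=\frac{q^n-q^{m+n-\ell}}{\sqrt{q^{m+n-\ell}(1-q^m)(1-q^{n-\ell})}}.$$
   Context: For two non-degenerate random variables $X$ and $Y$ on the same probability space, the maximal correlation coefficient is $$R(X,Y)=\sup\frac{\operatorname{Cov}(\varphi(X),\psi(Y))}{\sqrt{\operatorname{Var}(\varphi(X))\operatorname{Var}(\psi(Y))}},$$ where the supremum is over all (real-valued) measurable functions $\varphi$ and $\psi$ such that $\operatorname{Var}(\varphi(X)),\operatorname{Var}(\psi(Y))\in(0,\infty)$. *)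

theory Defs
  imports "HOL-Probability.Probability"
begin

definition covariance :: "'a measure \<Rightarrow> ('a \<Rightarrow> real) \<Rightarrow> ('a \<Rightarrow> real) \<Rightarrow> real" where
  "covariance M U V =
     prob_space.expectation M (\<lambda>\<omega>. (U \<omega> - prob_space.expectation M U) *
                                 (V \<omega> - prob_space.expectation M V))"

(* The library variance is a real number, so its finiteness is stated as square integrability;
   on a probability space the mean then exists as well. *)
definition pos_finite_variance :: "'a measure \<Rightarrow> ('a \<Rightarrow> real) \<Rightarrow> bool" where
  "pos_finite_variance M U \<longleftrightarrow>
     U \<in> borel_measurable M \<and> integrable M (\<lambda>\<omega>. (U \<omega>)\<^sup>2) \<and> 0 < prob_space.variance M U"

(* The supremum is taken in the reals. On a probability space with X and Y random variables
   the set is bounded above by 1 (Cauchy-Schwarz), and it is nonempty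
   as soon as X and Y are both non-degenerate. *)
definition maximal_correlation :: "'a measure \<Rightarrow> ('a \<Rightarrow> real) \<Rightarrow> ('a \<Rightarrow> real) \<Rightarrow> real" where
  "maximal_correlation M X Y =
     Sup {covariance M (\<phi> \<circ> X) (\<psi> \<circ> Y) /
            sqrt (prob_space.variance M (\<phi> \<circ> X) * prob_space.variance M (\<psi> \<circ> Y))
          | \<phi> \<psi>. \<phi> \<in> borel_measurable borel \<and> \<psi> \<in> borel_measurable borel \<and>
              pos_finite_variance M (\<phi> \<circ> X) \<and> pos_finite_variance M (\<psi> \<circ> Y)}"

(* poisson_pmf lives on nat; this is its image on the real line. Meaningful for 0 < l only. *)
definition poisson_distribution :: "real \<Rightarrow> real measure" where
  "poisson_distribution l = distr (measure_pmf (poisson_pmf l)) borel real"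

(* Used for l < m \<le> n, so the subtractions on nat do not truncate. *)
definition R_minima :: "nat \<Rightarrow> nat \<Rightarrow> nat \<Rightarrow> real \<Rightarrow> real" where
  "R_minima n m l q =
     (q ^ n - q ^ (m + n - l)) / sqrt (q ^ (m + n - l) * (1 - q ^ m) * (1 - q ^ (n - l)))"

end

theory Submission
  imports Defs
begin

text \<open>Write \<open>U = min A C\<close> and \<open>V = min B C\<close>, where \<open>A\<close>, \<open>B\<close>, \<open>C\<close> are the minima over the
  \<open>a = l\<close> indices used only by \<open>U\<close>, the \<open>b = n - m\<close> used only by \<open>V\<close>, and the \<open>c = m - l\<close> common ones,
  and put \<open>G k = P(X \<ge> k)\<close>. Passing from the conditional law given \<open>U, V \<ge> k\<close> to that given
  \<open>U, V \<ge> k + 1\<close>, the weighted conditional variances of \<open>\<phi>(U)\<close> and \<open>\<psi>(V)\<close> and their covariance drop by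
  \<open>P(U > k) (1 - g^(a+c)) \<alpha>^2\<close>, \<open>P(V > k) (1 - g^(b+c)) \<beta>^2\<close> and \<open>P(U, V > k) (1 - g^c) \<alpha> \<beta>\<close>,
  where \<open>g = G (k+1) / G k\<close>, \<open>\<alpha> = E(\<phi>(U) | U > k) - \<phi>(k)\<close> and \<open>\<beta> = E(\<psi>(V) | V > k) - \<psi>(k)\<close>.
  So each layer contributes correlation at most \<open>R(g)\<close>. Since \<open>R\<close> is increasing and, for the Poisson
  law, \<open>g \<le> q = G 1\<close>, summing over the layers bounds the correlation by \<open>R(q)\<close>, which the
  indicators of \<open>U \<ge> 1\<close> and \<open>V \<ge> 1\<close> attain.\<close>

section \<open>Monotonicity of \<open>R_minima\<close> and the bound for a single layer\<close>

text \<open>After cross multiplication, \<open>1 - z ^ c\<close> and \<open>1 - z ^ a\<close> are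
  \<open>1 - z\<close> times geometric sums, and the products of these sums compare term by term.
  The quotient is one of the two factors of the square of \<open>R_minima\<close>.\<close>

lemma power_quotient_mono:
  fixes x y :: real
  assumes "0 < x" "x \<le> y" "y < 1" "0 < c"
  shows "x ^ a * (1 - x ^ c) / (1 - x ^ (a + c)) \<le> y ^ a * (1 - y ^ c) / (1 - y ^ (a + c))"
proof -
  have lt: "x ^ (a + c) < 1" "y ^ (a + c) < 1"
    using assms by (auto intro!: power_less_one_iff[THEN iffD2])
  have "(\<Sum>i<c. x ^ (i + a)) * (\<Sum>j<a. y ^ j) \<le> (\<Sum>i<c. y ^ (i + a)) * (\<Sum>j<a. x ^ j)"
    unfolding sum_product
  proof (intro sum_mono)
    fix i j assume "j \<in> {..<a}"
    \<comment> \<open>Since \<open>j < a\<close>, the exponent \<open>i + a\<close> exceeds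
      \<open>j\<close>, so after removing the common factor \<open>x ^ j * y ^ j\<close> only
      \<open>x ^ e \<le> y ^ e\<close> remains.\<close>
    then obtain e where e: "i + a = j + e" by (metis lessThan_iff less_imp_le_nat nat_le_iff_add trans_le_add2)
    have "x ^ e \<le> y ^ e" using assms by (intro power_mono) auto
    then have "(x ^ j * y ^ j) * x ^ e \<le> (x ^ j * y ^ j) * y ^ e"
      using assms by (intro mult_left_mono) auto
    then show "x ^ (i + a) * y ^ j \<le> y ^ (i + a) * x ^ j"
      by (simp add: e power_add mult_ac)
  qed
  then have "((1 - x) * (1 - y)) * ((\<Sum>i<c. x ^ (i + a)) * (\<Sum>j<a. y ^ j))
      \<le> ((1 - x) * (1 - y)) * ((\<Sum>i<c. y ^ (i + a)) * (\<Sum>j<a. x ^ j))"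
    using assms by (intro mult_left_mono) auto
  moreover have c: "(1 - z) * (\<Sum>i<c. z ^ (i + a)) = z ^ a * (1 - z ^ c)" for z :: real
    using one_diff_power_eq[of z c] by (simp add: power_add sum_distrib_right[symmetric] mult_ac)
  moreover have a: "(1 - z) * (\<Sum>j<a. z ^ j) = 1 - z ^ a" for z :: real
    using one_diff_power_eq[of z a] by simp
  moreover have "((1 - w) * (1 - z)) * (u * v) = ((1 - w) * u) * ((1 - z) * v)"
    "((1 - w) * (1 - z)) * (u * v) = ((1 - z) * u) * ((1 - w) * v)" for w z u v :: real
    by (simp_all add: mult_ac)
  ultimately have "x ^ a * (1 - x ^ c) * (1 - y ^ a) \<le> y ^ a * (1 - y ^ c) * (1 - x ^ a)"
    by (metis c a)
  \<comment> \<open>From \<open>1 - y ^ (a + c) = (1 - y ^ a) + y ^ a * (1 - y ^ c)\<close> and its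
    analogue for \<open>x\<close>, both sides gain the same term
    \<open>x ^ a * (1 - x ^ c) * y ^ a * (1 - y ^ c)\<close>.\<close>
  then have "x ^ a * (1 - x ^ c) * (1 - y ^ (a + c)) \<le> y ^ a * (1 - y ^ c) * (1 - x ^ (a + c))"
    by (simp add: power_add algebra_simps)
  then show ?thesis
    using lt by (simp add: divide_simps)
qed

text \<open>The numerator is \<open>q ^ (a + b + c) * (1 - q ^ c)\<close>, hence nonnegative, and
  can be moved under the root. The parameters are \<open>n = a + b + c\<close>,
  \<open>m = a + c\<close>, \<open>l = a\<close>; each factor under the root is increasing in
  \<open>q\<close>.\<close>

lemma R_minima_eq_sqrt:
  assumes "0 < q" "q < 1" "0 < c"
  shows "R_minima (a + b + c) (a + c) a q =
    sqrt ((q ^ a * (1 - q ^ c) / (1 - q ^ (a + c))) * (q ^ b * (1 - q ^ c) / (1 - q ^ (b + c))))"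
proof -
  define N D where "N = q ^ (a + b + c) - q ^ (a + c + (b + c))"
    and "D = q ^ (a + c + (b + c)) * (1 - q ^ (a + c)) * (1 - q ^ (b + c))"
  have lt: "q ^ c < 1" "q ^ (a + c) < 1" "q ^ (b + c) < 1"
    using assms by (auto intro!: power_less_one_iff[THEN iffD2])
  have N: "N = q ^ (a + b + c) * (1 - q ^ c)"
    by (simp add: N_def power_add algebra_simps)
  have "N \<ge> 0" using lt assms by (simp add: N)
  have "R_minima (a + b + c) (a + c) a q = N / sqrt D"
    by (simp add: R_minima_def N_def D_def add_ac)
  also have "\<dots> = sqrt (N\<^sup>2 / D)"
    using \<open>N \<ge> 0\<close> by (simp add: real_sqrt_divide)
  also have "N\<^sup>2 / D = (q ^ a * (1 - q ^ c) / (1 - q ^ (a + c))) * (q ^ b * (1 - q ^ c) / (1 - q ^ (b + c)))"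
    using lt assms unfolding N D_def
    by (simp add: divide_simps power_add power2_eq_square)
  finally show ?thesis .
qed

lemma R_minima_mono:
  assumes "0 < g" "g \<le> q" "q < 1" "0 < c"
  shows "R_minima (a + b + c) (a + c) a g \<le> R_minima (a + b + c) (a + c) a q"
proof -
  have nonneg: "0 \<le> z ^ d * (1 - z ^ c) / (1 - z ^ (d + c))" if "0 < z" "z < 1" for z :: real and d
    using that by (intro divide_nonneg_nonneg mult_nonneg_nonneg) (auto simp: power_le_one)
  show ?thesis
    using assms
    by (subst (1 2) R_minima_eq_sqrt; (intro real_sqrt_le_mono mult_mono power_quotient_mono nonneg)?) auto
qed

text \<open>The correlation bound for one layer, with \<open>h\<close> standing for
  \<open>G k\<close> and \<open>g * h\<close> for \<open>G (k + 1)\<close>. The right side splits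
  into \<open>R_minima\<close> at \<open>g\<close> times a root, and monotonicity then replaces
  \<open>g\<close> by \<open>q\<close>.\<close>

lemma R_minima_step:
  assumes "0 < g" "g \<le> q" "q < 1" "0 < c" "0 < h" "h \<le> 1"
  shows "(g * h) ^ (a + b + c) * (1 - g ^ c) \<le> R_minima (a + b + c) (a + c) a q *
    sqrt (((g * h) ^ (a + c) * (1 - g ^ (a + c))) * ((g * h) ^ (b + c) * (1 - g ^ (b + c))))"
proof -
  define A B where "A = 1 - g ^ (a + c)" and "B = 1 - g ^ (b + c)"
  have pos: "A > 0" "B > 0" "1 - g ^ c > 0"
    using assms by (auto simp: A_def B_def intro!: power_less_one_iff[THEN iffD2])
  \<comment> \<open>After squaring, the left side and the bound with \<open>g\<close> in place of
    \<open>q\<close> differ only in this factor, so the loss comes from \<open>h \<le> 1\<close>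
    alone.\<close>
  have "(g * h) ^ (a + b) \<le> g ^ (a + b)"
    using assms by (intro power_mono) (auto simp: mult_left_le)
  then have le: "(g * h) ^ (a + b) * ((g * h) ^ (a + b + c + c) * (1 - g ^ c)\<^sup>2) \<le>
      g ^ (a + b) * ((g * h) ^ (a + b + c + c) * (1 - g ^ c)\<^sup>2)"
    using assms by (intro mult_right_mono) auto
  have "(g * h) ^ (a + b + c) * (1 - g ^ c) = sqrt (((g * h) ^ (a + b + c) * (1 - g ^ c))\<^sup>2)"
    using assms pos by simp
  also have "\<dots> \<le> sqrt ((g ^ a * (1 - g ^ c) / A * (g ^ b * (1 - g ^ c) / B)) *
      (((g * h) ^ (a + c) * A) * ((g * h) ^ (b + c) * B)))"
    using le pos by (intro real_sqrt_le_mono) (simp add: power2_eq_square power_add mult_ac)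
  also have "\<dots> = R_minima (a + b + c) (a + c) a g *
      sqrt (((g * h) ^ (a + c) * A) * ((g * h) ^ (b + c) * B))"
    unfolding A_def B_def using assms by (subst R_minima_eq_sqrt) (auto simp only: real_sqrt_mult)
  also have "\<dots> \<le> R_minima (a + b + c) (a + c) a q *
      sqrt (((g * h) ^ (a + c) * A) * ((g * h) ^ (b + c) * B))"
    using assms pos by (intro mult_right_mono R_minima_mono) auto
  finally show ?thesis by (simp only: A_def B_def)
qed

text \<open>AM-GM for \<open>u\<close> and \<open>v\<close>, whose product does not depend on
  \<open>t\<close>. The resulting bound is linear in the two variance terms, so it can be summed
  over layers with a common \<open>t\<close> that is chosen only at the end.\<close>

lemma weighted_AM_GM:
  fixes x y P Q k \<rho> t :: real
  assumes "k \<le> \<rho> * sqrt (P * Q)" "0 \<le> k" "0 \<le> \<rho>" "0 \<le> P" "0 \<le> Q" "0 < t"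
  shows "2 * (k * (x * y)) \<le> \<rho> * (t * (P * x\<^sup>2) + (Q * y\<^sup>2) / t)"
proof -
  define u v where "u = sqrt (t * P) * \<bar>x\<bar>" and "v = sqrt (Q / t) * \<bar>y\<bar>"
  have uv: "u * v = sqrt (P * Q) * \<bar>x * y\<bar>"
    using assms by (simp add: u_def v_def abs_mult real_sqrt_mult real_sqrt_divide)
  have u: "u\<^sup>2 = t * (P * x\<^sup>2)" and v: "v\<^sup>2 = Q * y\<^sup>2 / t"
    using assms by (auto simp: u_def v_def power_mult_distrib)
  have "k * (x * y) \<le> k * \<bar>x * y\<bar>"
    using assms by (intro mult_left_mono) auto
  also have "\<dots> \<le> \<rho> * sqrt (P * Q) * \<bar>x * y\<bar>"
    using assms by (intro mult_right_mono) auto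
  finally have "2 * (k * (x * y)) \<le> \<rho> * (2 * u * v)"
    using uv by (simp add: mult_ac)
  also have "\<dots> \<le> \<rho> * (u\<^sup>2 + v\<^sup>2)"
    using assms by (intro mult_left_mono sum_squares_bound) auto
  finally show ?thesis by (simp add: u v)
qed

section \<open>Tails of the Poisson law\<close>

lemma poisson_tail_sums:
  "(\<lambda>j. pmf (poisson_pmf lam) (k + j)) sums measure_pmf.prob (poisson_pmf lam) {k..}"
proof -
  have "(\<Union>j. {k + j}) = {k..}"
    using le_Suc_ex by auto
  moreover have "(\<lambda>j. measure_pmf.prob (poisson_pmf lam) {k + j}) sums
      measure_pmf.prob (poisson_pmf lam) (\<Union>j. {k + j})"
    by (rule measure_pmf.finite_measure_UNION) (auto simp: disjoint_family_on_def)
  ultimately show ?thesis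
    by (simp add: measure_pmf_single)
qed

lemma poisson_tail_0: "measure_pmf.prob (poisson_pmf lam) {0..} = 1"
  by (simp add: atLeast_0 measure_pmf.prob_space)

lemma poisson_tail_Suc:
  "measure_pmf.prob (poisson_pmf lam) {Suc k..} =
    measure_pmf.prob (poisson_pmf lam) {k..} - pmf (poisson_pmf lam) k"
proof -
  have "{k..} = insert k {Suc k..}" by auto
  then have "measure_pmf.prob (poisson_pmf lam) {k..} =
      measure_pmf.prob (poisson_pmf lam) {k} + measure_pmf.prob (poisson_pmf lam) {Suc k..}"
    by (subst measure_pmf.finite_measure_Union[symmetric]) auto
  then show ?thesis by (simp add: measure_pmf_single)
qed

lemma poisson_tail_1:
  assumes "0 < lam"
  shows "measure_pmf.prob (poisson_pmf lam) {1..} = 1 - exp (- lam)"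
  using poisson_tail_Suc[of lam 0] assms by (simp add: poisson_tail_0[simplified] )

lemma poisson_tail_pos:
  assumes "0 < lam"
  shows "0 < measure_pmf.prob (poisson_pmf lam) {k..}"
proof -
  have "0 < pmf (poisson_pmf lam) k" using assms by simp
  also have "\<dots> = measure_pmf.prob (poisson_pmf lam) {k}" by (simp add: measure_pmf_single)
  also have "\<dots> \<le> measure_pmf.prob (poisson_pmf lam) {k..}"
    by (intro measure_pmf.finite_measure_mono) auto
  finally show ?thesis .
qed

text \<open>The Poisson law is ``new better than used'': the conditional survival probabilities
  \<open>P(X > k | X \<ge> k)\<close> are largest at \<open>k = 0\<close>.\<close>

lemma poisson_tail_Suc_le:
  assumes "0 < lam"
  shows "measure_pmf.prob (poisson_pmf lam) {Suc k..} \<le>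
    (1 - exp (- lam)) * measure_pmf.prob (poisson_pmf lam) {k..}"
proof -
  \<comment> \<open>Comparing the tail series termwise with the Poisson mass function through
    \<open>fact k * fact j \<le> fact (k + j)\<close>. Multiplied by \<open>exp (- lam)\<close>,
    this says \<open>exp (- lam) * P(X \<ge> k) \<le> P(X = k)\<close>, which rearranges to the
    claim.\<close>
  have "measure_pmf.prob (poisson_pmf lam) {k..} \<le> lam ^ k / fact k * 1"
  proof (rule sums_le[OF _ poisson_tail_sums])
    show "(\<lambda>j. lam ^ k / fact k * pmf (poisson_pmf lam) j) sums (lam ^ k / fact k * 1)"
      using poisson_tail_sums[of lam 0] by (intro sums_mult) (simp add: poisson_tail_0[simplified])
    fix j
    have "fact k * fact j \<le> (fact (k + j) :: real)"
    proof -
      have "fact k * fact j dvd (fact (k + j) :: nat)" by (rule fact_fact_dvd_fact)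
      then have "fact k * fact j \<le> (fact (k + j) :: nat)" by (rule dvd_imp_le) simp
      then show ?thesis by (metis of_nat_fact of_nat_le_iff of_nat_mult)
    qed
    then have "lam ^ (k + j) / fact (k + j) * exp (- lam) \<le> lam ^ (k + j) / (fact k * fact j) * exp (- lam)"
      using assms by (intro mult_right_mono divide_left_mono) auto
    then show "pmf (poisson_pmf lam) (k + j) \<le> lam ^ k / fact k * pmf (poisson_pmf lam) j"
      using assms by (simp add: power_add)
  qed
  then have "exp (- lam) * measure_pmf.prob (poisson_pmf lam) {k..} \<le> exp (- lam) * (lam ^ k / fact k)"
    by (intro mult_left_mono) auto
  also have "\<dots> = pmf (poisson_pmf lam) k" using assms by simp
  finally show ?thesis by (simp add: poisson_tail_Suc algebra_simps)
qed

section \<open>Algebra of removing one atom, and integrability of products\<close>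

text \<open>An atom of mass \<open>P - P'\<close> at value \<open>x\<close> is joined to a block of
  mass \<open>P'\<close> and mean \<open>m' / P'\<close>. The right side is the between-group term
  of the variance decomposition.\<close>

lemma tail_variance_step:
  fixes P P' x s m m' :: real
  assumes "0 < P" "0 < P'" "s = s' + x\<^sup>2 * (P - P')" "m = m' + x * (P - P')"
  shows "(s - m\<^sup>2 / P) - (s' - m'\<^sup>2 / P') = P' * (1 - P' / P) * (m' / P' - x)\<^sup>2"
proof -
  define y where "y = m' / P'"
  have m': "m' = P' * y" using assms by (simp add: y_def)
  show ?thesis
    unfolding y_def[symmetric] assms(3,4) m' using assms(1,2)
    by (simp add: power2_eq_square divide_simps) (simp add: algebra_simps)
qed

text \<open>The last hypothesis is the expanded form of the fact that the integral of
  \<open>(\<phi>(U) - x) (\<psi>(V) - y)\<close> is the same over \<open>U, V \<ge> k\<close> and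
  over \<open>U, V \<ge> k + 1\<close>. Recentering both sides at the conditional means, where the
  old deviation \<open>\<mu> - x\<close> is \<open>P' / P\<close> times the new one and likewise for
  \<open>\<nu> - y\<close>, gives the drop.\<close>

lemma tail_covariance_step:
  fixes P P' Q Q' S S' x y e e' \<mu> \<mu>' \<nu> \<nu>' :: real
  assumes "0 < P" "0 < Q"
    and \<mu>: "P * \<mu> = P' * \<mu>' + x * (P - P')" and \<nu>: "Q * \<nu> = Q' * \<nu>' + y * (Q - Q')"
    and e: "e - x * (S * \<nu>) - y * (S * \<mu>) + x * y * S =
      e' - x * (S' * \<nu>') - y * (S' * \<mu>') + x * y * S'"
  shows "(e - S * \<mu> * \<nu>) - (e' - S' * \<mu>' * \<nu>') =
    (S' - S * (P' / P) * (Q' / Q)) * ((\<mu>' - x) * (\<nu>' - y))"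
proof -
  define p q where "p = P' / P" and "q = Q' / Q"
  have "\<mu> - x = p * (\<mu>' - x)" "\<nu> - y = q * (\<nu>' - y)"
    using \<mu> \<nu> assms(1,2) by (auto simp: p_def q_def divide_simps algebra_simps)
  then have "S * ((\<mu> - x) * (\<nu> - y)) = S * ((p * (\<mu>' - x)) * (q * (\<nu>' - y)))"
    by (simp only:)
  moreover have "e - S * \<mu> * \<nu> + S * ((\<mu> - x) * (\<nu> - y)) =
      e' - S' * \<mu>' * \<nu>' + S' * ((\<mu>' - x) * (\<nu>' - y))"
    using e by (simp add: algebra_simps)
  ultimately show ?thesis unfolding p_def[symmetric] q_def[symmetric] by (simp add: algebra_simps)
qed

lemma integrable_mult_bounded:
  fixes f g :: "'a \<Rightarrow> real"
  assumes "integrable M f" "g \<in> borel_measurable M" "\<And>x. \<bar>g x\<bar> \<le> 1"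
  shows "integrable M (\<lambda>x. f x * g x)"
  using assms
  by (intro Bochner_Integration.integrable_bound[OF assms(1)]) (auto simp: abs_mult mult_left_le)

lemma integrable_mult_square_integrable:
  fixes f g :: "'a \<Rightarrow> real"
  assumes [measurable]: "f \<in> borel_measurable M" "g \<in> borel_measurable M"
    and "integrable M (\<lambda>x. (f x)\<^sup>2)" "integrable M (\<lambda>x. (g x)\<^sup>2)"
  shows "integrable M (\<lambda>x. f x * g x)"
proof (rule Bochner_Integration.integrable_bound)
  show "integrable M (\<lambda>x. (f x)\<^sup>2 + (g x)\<^sup>2)" using assms by auto
  have "2 * (\<bar>y\<bar> * \<bar>z\<bar>) \<le> y\<^sup>2 + z\<^sup>2" for y z :: real
    using sum_squares_bound[of "\<bar>y\<bar>" "\<bar>z\<bar>"] by simp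
  then have "\<bar>y * z\<bar> \<le> y\<^sup>2 + z\<^sup>2" for y z :: real
    using abs_ge_zero[of "y * z"] unfolding abs_mult by (metis add_increasing2 mult_2 order.trans order_refl)
  then show "AE x in M. norm (f x * g x) \<le> norm ((f x)\<^sup>2 + (g x)\<^sup>2)" by simp
qed simp

section \<open>Layers of two overlapping minima\<close>

text \<open>Abstracts from \<open>A\<close>, \<open>B\<close>, \<open>C\<close>: given \<open>U \<ge> k\<close>, the event \<open>V \<ge> k\<close> is that of \<open>B \<ge> k\<close>,
  which is independent of \<open>U\<close> and has probability \<open>G k ^ b\<close>.\<close>

locale overlapping_minima = prob_space M for M :: "'a measure" +
  fixes U V :: "'a \<Rightarrow> real" and G :: "nat \<Rightarrow> real" and a b c :: nat
  assumes U_measurable [measurable]: "U \<in> borel_measurable M"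
    and V_measurable [measurable]: "V \<in> borel_measurable M"
    and U_Nats: "AE \<omega> in M. U \<omega> \<in> \<nat>"
    and V_Nats: "AE \<omega> in M. V \<omega> \<in> \<nat>"
    and G_0: "G 0 = 1"
    and G_1: "G 1 < 1"
    and G_pos: "\<And>k. 0 < G k"
    and G_Suc_le: "\<And>k. G (Suc k) \<le> G 1 * G k"
    and c_pos: "0 < c"
    and U_tail: "\<And>k. expectation (\<lambda>\<omega>. indicator {real k..} (U \<omega>)) = G k ^ (a + c)"
    and V_tail: "\<And>k. expectation (\<lambda>\<omega>. indicator {real k..} (V \<omega>)) = G k ^ (b + c)"
    and U_both: "\<And>f k. f \<in> borel_measurable borel \<Longrightarrow> integrable M (\<lambda>\<omega>. f (U \<omega>)) \<Longrightarrow>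
      expectation (\<lambda>\<omega>. f (U \<omega>) * (indicator {real k..} (U \<omega>) * indicator {real k..} (V \<omega>))) =
        G k ^ b * expectation (\<lambda>\<omega>. f (U \<omega>) * indicator {real k..} (U \<omega>))"
    and V_both: "\<And>f k. f \<in> borel_measurable borel \<Longrightarrow> integrable M (\<lambda>\<omega>. f (V \<omega>)) \<Longrightarrow>
      expectation (\<lambda>\<omega>. f (V \<omega>) * (indicator {real k..} (U \<omega>) * indicator {real k..} (V \<omega>))) =
        G k ^ a * expectation (\<lambda>\<omega>. f (V \<omega>) * indicator {real k..} (V \<omega>))"
begin

text \<open>The assumptions are symmetric under exchanging \<open>U\<close> with \<open>V\<close>
  and \<open>a\<close> with \<open>b\<close>, so each fact about \<open>U\<close> becomes available
  for \<open>V\<close>.\<close>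

lemma swap: "overlapping_minima M V U G b a c"
  using U_Nats V_Nats G_0 G_1 G_pos G_Suc_le c_pos U_tail V_tail U_both V_both
  by unfold_locales (auto simp: mult.commute[of "indicator _ (V _) :: real"])

lemma G_le_1: "G k \<le> 1"
proof (induction k)
  case (Suc k)
  have "G (Suc k) \<le> G 1 * G k" by (rule G_Suc_le)
  also have "\<dots> \<le> 1 * 1" using G_1 G_pos[of k] Suc by (intro mult_mono) auto
  finally show ?case by simp
qed (simp add: G_0)

text \<open>On the naturals the two indicators differ only at \<open>x = k\<close>, where the other
  factor vanishes.\<close>

lemma indicator_Nats_Suc:
  fixes f :: "real \<Rightarrow> real"
  assumes "x \<in> \<nat>"
  shows "(f x - f (real k)) * indicator {real k..} x = (f x - f (real k)) * indicator {real (Suc k)..} x"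
proof -
  obtain j where "x = real j" using assms by (auto simp: Nats_def)
  then show ?thesis by (cases "j = k") (auto simp: indicator_def)
qed

text \<open>The conditional mean of \<open>f(U)\<close> given \<open>U \<ge> k\<close>, since
  \<open>G k ^ (a + c)\<close> is the probability of that event.\<close>

definition mean_above :: "(real \<Rightarrow> real) \<Rightarrow> nat \<Rightarrow> real" where
  "mean_above f k = expectation (\<lambda>\<omega>. f (U \<omega>) * indicator {real k..} (U \<omega>)) / G k ^ (a + c)"

text \<open>The conditional variance given \<open>U \<ge> k\<close> multiplied by
  \<open>P(U \<ge> k)\<close>. With this weight the layer drops telescope and what remains tends to
  0.\<close>

definition variance_above :: "(real \<Rightarrow> real) \<Rightarrow> nat \<Rightarrow> real" where
  "variance_above f k = expectation (\<lambda>\<omega>. (f (U \<omega>))\<^sup>2 * indicator {real k..} (U \<omega>)) -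
     G k ^ (a + c) * (mean_above f k)\<^sup>2"

text \<open>Splits off the atom at \<open>k\<close>. Only integrability is assumed, so that it
  applies to \<open>f\<close> and to its square.\<close>

lemma expectation_above_Suc:
  assumes [measurable]: "f \<in> borel_measurable borel" and int: "integrable M (\<lambda>\<omega>. f (U \<omega>))"
  shows "expectation (\<lambda>\<omega>. f (U \<omega>) * indicator {real k..} (U \<omega>)) =
    expectation (\<lambda>\<omega>. f (U \<omega>) * indicator {real (Suc k)..} (U \<omega>)) +
      f k * (G k ^ (a + c) - G (Suc k) ^ (a + c))"
proof -
  have "expectation (\<lambda>\<omega>. f (U \<omega>) * indicator {real k..} (U \<omega>)) =
    expectation (\<lambda>\<omega>. f (U \<omega>) * indicator {real (Suc k)..} (U \<omega>) +
      f k * (indicator {real k..} (U \<omega>) - indicator {real (Suc k)..} (U \<omega>)))"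
  proof (rule integral_cong_AE)
    show "AE \<omega> in M. f (U \<omega>) * indicator {real k..} (U \<omega>) = f (U \<omega>) * indicator {real (Suc k)..} (U \<omega>) +
        f k * (indicator {real k..} (U \<omega>) - indicator {real (Suc k)..} (U \<omega>))"
      using U_Nats
    proof eventually_elim
      fix \<omega> assume "U \<omega> \<in> \<nat>"
      from indicator_Nats_Suc[OF this, of f k] show "f (U \<omega>) * indicator {real k..} (U \<omega>) = f (U \<omega>) * indicator {real (Suc k)..} (U \<omega>) +
        f k * (indicator {real k..} (U \<omega>) - indicator {real (Suc k)..} (U \<omega>))"
        by (simp add: algebra_simps)
    qed
  qed measurable
  also have "\<dots> = expectation (\<lambda>\<omega>. f (U \<omega>) * indicator {real (Suc k)..} (U \<omega>)) +
      f k * (G k ^ (a + c) - G (Suc k) ^ (a + c))"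
  proof -
    have [simp]: "integrable M (\<lambda>\<omega>. indicator {real k..} (U \<omega>) :: real)" for k
      by (rule integrable_const_bound[of _ 1]) auto
    have [simp]: "integrable M (\<lambda>\<omega>. f (U \<omega>) * indicator {real (Suc k)..} (U \<omega>))"
      using int by (rule integrable_mult_bounded) auto
    show ?thesis by (simp add: U_tail del: of_nat_Suc)
  qed
  finally show ?thesis .
qed

context
  fixes f :: "real \<Rightarrow> real"
  assumes f [measurable]: "f \<in> borel_measurable borel"
    and f2: "integrable M (\<lambda>\<omega>. (f (U \<omega>))\<^sup>2)"
begin

lemma integrable_f: "integrable M (\<lambda>\<omega>. f (U \<omega>))"
  by (rule square_integrable_imp_integrable[OF _ f2]) measurable

lemma mean_above_Suc:
  "G k ^ (a + c) * mean_above f k =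
    G (Suc k) ^ (a + c) * mean_above f (Suc k) + f k * (G k ^ (a + c) - G (Suc k) ^ (a + c))"
  using expectation_above_Suc[OF f integrable_f, of k] G_pos[of k] G_pos[of "Suc k"]
  by (simp add: mean_above_def)

lemma variance_above_Suc:
  "variance_above f k - variance_above f (Suc k) =
    G (Suc k) ^ (a + c) * (1 - (G (Suc k) / G k) ^ (a + c)) * (mean_above f (Suc k) - f k)\<^sup>2"
proof -
  have eq: "G k ^ (a + c) * (x / G k ^ (a + c))\<^sup>2 = x\<^sup>2 / G k ^ (a + c)" for k x
    using G_pos[of k] by (simp add: power2_eq_square)
  show ?thesis
    unfolding variance_above_def mean_above_def eq power_divide[of "G _"]
    using G_pos by (intro tail_variance_step expectation_above_Suc integrable_f) (auto intro!: expectation_above_Suc f2)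
qed

text \<open>This centered form yields nonnegativity and, at \<open>k = 0\<close>, the ordinary
  variance.\<close>

lemma variance_above_eq:
  "variance_above f k = expectation (\<lambda>\<omega>. (f (U \<omega>) - mean_above f k)\<^sup>2 * indicator {real k..} (U \<omega>))"
proof -
  have [simp]: "integrable M (\<lambda>\<omega>. indicator {real k..} (U \<omega>) :: real)"
    by (rule integrable_const_bound[of _ 1]) auto
  have [simp]: "integrable M (\<lambda>\<omega>. f (U \<omega>) * indicator {real k..} (U \<omega>))"
    "integrable M (\<lambda>\<omega>. (f (U \<omega>))\<^sup>2 * indicator {real k..} (U \<omega>))"
    using integrable_f f2 by (auto intro!: integrable_mult_bounded)
  have "expectation (\<lambda>\<omega>. (f (U \<omega>) - mean_above f k)\<^sup>2 * indicator {real k..} (U \<omega>)) =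
    expectation (\<lambda>\<omega>. (f (U \<omega>))\<^sup>2 * indicator {real k..} (U \<omega>) -
      2 * mean_above f k * (f (U \<omega>) * indicator {real k..} (U \<omega>)) +
      (mean_above f k)\<^sup>2 * indicator {real k..} (U \<omega>))"
    by (intro Bochner_Integration.integral_cong) (auto simp: power2_eq_square algebra_simps)
  also have "\<dots> = expectation (\<lambda>\<omega>. (f (U \<omega>))\<^sup>2 * indicator {real k..} (U \<omega>)) -
      2 * mean_above f k * (G k ^ (a + c) * mean_above f k) + (mean_above f k)\<^sup>2 * G k ^ (a + c)"
    using G_pos[of k] by (simp add: U_tail) (simp add: mean_above_def)
  also have "\<dots> = variance_above f k"
    by (simp add: variance_above_def power2_eq_square)
  finally show ?thesis by simp
qed

lemma variance_above_nonneg: "0 \<le> variance_above f k"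
  unfolding variance_above_eq by (intro integral_nonneg_AE) auto

text \<open>It lies between 0 and the integral of the square of \<open>f(U)\<close> over
  \<open>U \<ge> k\<close>, which vanishes in the limit by dominated convergence.\<close>

lemma variance_above_tendsto_0: "(\<lambda>k. variance_above f k) \<longlonglongrightarrow> 0"
proof -
  have "(\<lambda>k. expectation (\<lambda>\<omega>. (f (U \<omega>))\<^sup>2 * indicator {real k..} (U \<omega>))) \<longlonglongrightarrow> expectation (\<lambda>_. 0)"
  proof (rule integral_dominated_convergence[OF _ _ f2])
    show "AE \<omega> in M. (\<lambda>k. (f (U \<omega>))\<^sup>2 * indicator {real k..} (U \<omega>)) \<longlonglongrightarrow> 0"
    proof (rule AE_I2)
      fix \<omega>
      obtain K :: nat where "U \<omega> < K" using reals_Archimedean2 by blast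
      then have "\<forall>\<^sub>F k in sequentially. (f (U \<omega>))\<^sup>2 * indicator {real k..} (U \<omega>) = 0"
        by (intro eventually_sequentiallyI[of K]) (auto simp: indicator_def)
      then show "(\<lambda>k. (f (U \<omega>))\<^sup>2 * indicator {real k..} (U \<omega>)) \<longlonglongrightarrow> 0"
        by (rule tendsto_eventually)
    qed
  qed (auto simp: indicator_def)
  moreover have "\<forall>\<^sub>F k in sequentially. 0 \<le> variance_above f k"
    by (simp add: variance_above_nonneg)
  moreover have "\<forall>\<^sub>F k in sequentially.
      variance_above f k \<le> expectation (\<lambda>\<omega>. (f (U \<omega>))\<^sup>2 * indicator {real k..} (U \<omega>))"
    using G_pos by (simp add: variance_above_def less_imp_le)
  ultimately show ?thesis
    using tendsto_sandwich[OF _ _ tendsto_const] by fastforce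
qed

lemma expectation_above_0:
  fixes g :: "real \<Rightarrow> real"
  assumes [measurable]: "g \<in> borel_measurable borel"
  shows "expectation (\<lambda>\<omega>. g (U \<omega>) * indicator {real 0..} (U \<omega>)) = expectation (\<lambda>\<omega>. g (U \<omega>))"
proof (rule integral_cong_AE)
  show "AE \<omega> in M. g (U \<omega>) * indicator {real 0..} (U \<omega>) = g (U \<omega>)"
    using U_Nats
  proof eventually_elim
    fix \<omega> assume "U \<omega> \<in> \<nat>"
    then show "g (U \<omega>) * indicator {real 0..} (U \<omega>) = g (U \<omega>)"
      by (auto simp: Nats_def)
  qed
qed measurable

lemma mean_above_0: "mean_above f 0 = expectation (\<lambda>\<omega>. f (U \<omega>))"
  using expectation_above_0[OF f] by (simp add: mean_above_def G_0)

lemma variance_above_0: "variance_above f 0 = variance (\<lambda>\<omega>. f (U \<omega>))"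
  using expectation_above_0[of "\<lambda>x. (f x - mean_above f 0)\<^sup>2"]
  by (simp add: variance_above_eq mean_above_0)

end

section \<open>Covariance: one layer and the sum over layers\<close>

text \<open>Conditioning on \<open>V \<ge> k\<close> in addition to \<open>U \<ge> k\<close> leaves
  the mean of \<open>\<phi>(U)\<close> equal to \<open>\<mu> k\<close>, and symmetrically for
  \<open>\<psi>(V)\<close>. The first claim is the drop across a layer; the second, cruder one makes
  the remainder vanish after telescoping.\<close>

lemma covariance_above_Suc:
  fixes \<phi> \<psi> :: "real \<Rightarrow> real"
  defines "\<mu> \<equiv> mean_above \<phi>" and "\<nu> \<equiv> overlapping_minima.mean_above M V G b c \<psi>"
    and "e \<equiv> \<lambda>k. expectation (\<lambda>\<omega>. \<phi> (U \<omega>) * \<psi> (V \<omega>) * (indicator {real k..} (U \<omega>) * indicator {real k..} (V \<omega>)))"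
  assumes [measurable]: "\<phi> \<in> borel_measurable borel" "\<psi> \<in> borel_measurable borel"
    and \<phi>2: "integrable M (\<lambda>\<omega>. (\<phi> (U \<omega>))\<^sup>2)" and \<psi>2: "integrable M (\<lambda>\<omega>. (\<psi> (V \<omega>))\<^sup>2)"
  shows "(e k - G k ^ (a + b + c) * \<mu> k * \<nu> k) - (e (Suc k) - G (Suc k) ^ (a + b + c) * \<mu> (Suc k) * \<nu> (Suc k)) =
    G (Suc k) ^ (a + b + c) * (1 - (G (Suc k) / G k) ^ c) * ((\<mu> (Suc k) - \<phi> k) * (\<nu> (Suc k) - \<psi> k))"
    (is ?step)
    and "2 * (e k - G k ^ (a + b + c) * \<mu> k * \<nu> k) \<le>
      variance_above \<phi> k + overlapping_minima.variance_above M V G b c \<psi> k"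
    (is ?bound)
proof -
  interpret V: overlapping_minima M V U G b a c by (rule swap)
  define J :: "nat \<Rightarrow> 'a \<Rightarrow> real" where "J k \<omega> = indicator {real k..} (U \<omega>) * indicator {real k..} (V \<omega>)" for k \<omega>
  have J_meas [measurable]: "J k \<in> borel_measurable M" for k
    unfolding J_def by measurable
  have int: "integrable M (\<lambda>\<omega>. g \<omega> * J k \<omega>)" if "integrable M g" for g k
    using that by (rule integrable_mult_bounded) (auto simp: J_def indicator_def)
  note i\<phi> = integrable_f[OF _ \<phi>2] and i\<psi> = V.integrable_f[OF _ \<psi>2]
  have i\<phi>\<psi>: "integrable M (\<lambda>\<omega>. \<phi> (U \<omega>) * \<psi> (V \<omega>))"
    using \<phi>2 \<psi>2 by (intro integrable_mult_square_integrable) auto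
  have EJ: "expectation (J k) = G k ^ (a + b + c)" for k
  proof -
    have "expectation (J k) = G k ^ b * G k ^ (a + c)"
      using U_both[of "\<lambda>_. 1" k, OF borel_measurable_const integrable_const]
      unfolding mult_1_left U_tail J_def[abs_def] .
    then show ?thesis by (simp add: power_add mult_ac)
  qed
  have iJ: "integrable M (J k)" for k using int[of "\<lambda>_. 1"] by simp
  have E\<phi>: "expectation (\<lambda>\<omega>. \<phi> (U \<omega>) * J k \<omega>) = G k ^ (a + b + c) * \<mu> k" for k
    using U_both[OF _ i\<phi>, of k] G_pos[of k] by (simp add: J_def \<mu>_def mean_above_def power_add)
  have E\<psi>: "expectation (\<lambda>\<omega>. \<psi> (V \<omega>) * J k \<omega>) = G k ^ (a + b + c) * \<nu> k" for k
    using V_both[OF _ i\<psi>, of k] G_pos[of k] by (simp add: J_def \<nu>_def V.mean_above_def power_add)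
  \<comment> \<open>The centers are left free: \<open>\<phi> k\<close> and \<open>\<psi> k\<close>
    serve the layer identity, \<open>\<mu> k\<close> and \<open>\<nu> k\<close> the bound.\<close>
  have expand: "expectation (\<lambda>\<omega>. (\<phi> (U \<omega>) - x) * (\<psi> (V \<omega>) - y) * J k \<omega>) =
      e k - x * (G k ^ (a + b + c) * \<nu> k) - y * (G k ^ (a + b + c) * \<mu> k) + x * y * G k ^ (a + b + c)"
    for x y k
  proof -
    have "expectation (\<lambda>\<omega>. (\<phi> (U \<omega>) - x) * (\<psi> (V \<omega>) - y) * J k \<omega>) =
      expectation (\<lambda>\<omega>. \<phi> (U \<omega>) * \<psi> (V \<omega>) * J k \<omega> - x * (\<psi> (V \<omega>) * J k \<omega>) - y * (\<phi> (U \<omega>) * J k \<omega>) + x * y * J k \<omega>)"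
      by (intro Bochner_Integration.integral_cong) (auto simp: algebra_simps)
    also have "\<dots> = expectation (\<lambda>\<omega>. \<phi> (U \<omega>) * \<psi> (V \<omega>) * J k \<omega>) -
        x * expectation (\<lambda>\<omega>. \<psi> (V \<omega>) * J k \<omega>) - y * expectation (\<lambda>\<omega>. \<phi> (U \<omega>) * J k \<omega>) + x * y * expectation (J k)"
      using int[OF i\<phi>\<psi>] int[OF i\<phi>] int[OF i\<psi>] iJ by simp
    finally show ?thesis by (simp only: E\<phi> E\<psi> EJ e_def J_def[symmetric])
  qed
  \<comment> \<open>The integrand vanishes where \<open>U = k\<close> or \<open>V = k\<close>, so
    passing from \<open>k\<close> to \<open>Suc k\<close> in \<open>J\<close> costs nothing.\<close>
  have "expectation (\<lambda>\<omega>. (\<phi> (U \<omega>) - \<phi> k) * (\<psi> (V \<omega>) - \<psi> k) * J k \<omega>) =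
      expectation (\<lambda>\<omega>. (\<phi> (U \<omega>) - \<phi> k) * (\<psi> (V \<omega>) - \<psi> k) * J (Suc k) \<omega>)"
  proof (intro integral_cong_AE)
    show "AE \<omega> in M. (\<phi> (U \<omega>) - \<phi> k) * (\<psi> (V \<omega>) - \<psi> k) * J k \<omega> =
        (\<phi> (U \<omega>) - \<phi> k) * (\<psi> (V \<omega>) - \<psi> k) * J (Suc k) \<omega>"
      using U_Nats V_Nats
    proof eventually_elim
      fix \<omega> assume "U \<omega> \<in> \<nat>" "V \<omega> \<in> \<nat>"
      from indicator_Nats_Suc[OF this(1), of \<phi> k] indicator_Nats_Suc[OF this(2), of \<psi> k]
      have "((\<phi> (U \<omega>) - \<phi> k) * indicator {real k..} (U \<omega>)) * ((\<psi> (V \<omega>) - \<psi> k) * indicator {real k..} (V \<omega>)) =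
        ((\<phi> (U \<omega>) - \<phi> k) * indicator {real (Suc k)..} (U \<omega>)) * ((\<psi> (V \<omega>) - \<psi> k) * indicator {real (Suc k)..} (V \<omega>))"
        by (simp only:)
      then show "(\<phi> (U \<omega>) - \<phi> k) * (\<psi> (V \<omega>) - \<psi> k) * J k \<omega> =
        (\<phi> (U \<omega>) - \<phi> k) * (\<psi> (V \<omega>) - \<psi> k) * J (Suc k) \<omega>"
        by (simp only: J_def mult_ac)
    qed
  qed measurable
  \<comment> \<open>The two survival ratios together have exponent \<open>a + b + 2 * c\<close>: the
    common indices count twice, which leaves the extra power \<open>c\<close>.\<close>
  moreover have "G k ^ (a + b + c) * (G (Suc k) ^ (a + c) / G k ^ (a + c)) * (G (Suc k) ^ (b + c) / G k ^ (b + c))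
      = G (Suc k) ^ (a + b + c) * (G (Suc k) / G k) ^ c"
    using G_pos[of k] by (simp add: power_add power_divide)
  ultimately show ?step
    using tail_covariance_step[OF _ _ mean_above_Suc[OF _ \<phi>2] V.mean_above_Suc[OF _ \<psi>2], of k k "e k" "G k ^ (a + b + c)" "e (Suc k)" "G (Suc k) ^ (a + b + c)"]
      G_pos[of k]
    unfolding expand \<mu>_def \<nu>_def by (simp add: right_diff_distrib)
  have s\<phi>: "integrable M (\<lambda>\<omega>. (\<phi> (U \<omega>) - \<mu> k)\<^sup>2)" and s\<psi>: "integrable M (\<lambda>\<omega>. (\<psi> (V \<omega>) - \<nu> k)\<^sup>2)"
    using i\<phi> i\<psi> \<phi>2 \<psi>2 by (simp_all add: power2_diff)
  have "2 * (e k - G k ^ (a + b + c) * \<mu> k * \<nu> k) =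
      2 * expectation (\<lambda>\<omega>. (\<phi> (U \<omega>) - \<mu> k) * (\<psi> (V \<omega>) - \<nu> k) * J k \<omega>)"
    unfolding expand by (simp add: algebra_simps)
  also have "\<dots> = expectation (\<lambda>\<omega>. 2 * ((\<phi> (U \<omega>) - \<mu> k) * (\<psi> (V \<omega>) - \<nu> k) * J k \<omega>))"
    by simp
  also have "\<dots> \<le> expectation (\<lambda>\<omega>. (\<phi> (U \<omega>) - \<mu> k)\<^sup>2 * J k \<omega> + (\<psi> (V \<omega>) - \<nu> k)\<^sup>2 * J k \<omega>)"
  proof (rule integral_mono)
    show "2 * ((\<phi> (U \<omega>) - \<mu> k) * (\<psi> (V \<omega>) - \<nu> k) * J k \<omega>) \<le>
        (\<phi> (U \<omega>) - \<mu> k)\<^sup>2 * J k \<omega> + (\<psi> (V \<omega>) - \<nu> k)\<^sup>2 * J k \<omega>" for \<omega>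
    proof -
      have "2 * (\<phi> (U \<omega>) - \<mu> k) * (\<psi> (V \<omega>) - \<nu> k) * J k \<omega> \<le>
          ((\<phi> (U \<omega>) - \<mu> k)\<^sup>2 + (\<psi> (V \<omega>) - \<nu> k)\<^sup>2) * J k \<omega>"
        by (intro mult_right_mono sum_squares_bound) (simp add: J_def)
      then show ?thesis by (simp only: distrib_right mult.assoc)
    qed
    show "integrable M (\<lambda>\<omega>. (\<phi> (U \<omega>) - \<mu> k)\<^sup>2 * J k \<omega> + (\<psi> (V \<omega>) - \<nu> k)\<^sup>2 * J k \<omega>)"
      by (intro Bochner_Integration.integrable_add int s\<phi> s\<psi>)
    have "integrable M (\<lambda>\<omega>. (\<phi> (U \<omega>) - \<mu> k) * (\<psi> (V \<omega>) - \<nu> k))"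
      by (intro integrable_mult_square_integrable s\<phi> s\<psi>) measurable
    then show "integrable M (\<lambda>\<omega>. 2 * ((\<phi> (U \<omega>) - \<mu> k) * (\<psi> (V \<omega>) - \<nu> k) * J k \<omega>))"
      by (intro integrable_mult_right int)
  qed
  \<comment> \<open>\<open>U_both\<close> and \<open>V_both\<close> apply to the squared deviations;
    the powers of \<open>G k\<close> are then bounded by 1.\<close>
  also have "\<dots> = G k ^ b * variance_above \<phi> k + G k ^ a * V.variance_above \<psi> k"
  proof -
    show ?thesis
      using U_both[OF _ s\<phi>, of k] V_both[OF _ s\<psi>, of k] int[OF s\<phi>] int[OF s\<psi>]
      by (simp add: variance_above_eq[OF _ \<phi>2] V.variance_above_eq[OF _ \<psi>2] J_def \<mu>_def \<nu>_def)
  qed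
  also have "\<dots> \<le> 1 * variance_above \<phi> k + 1 * V.variance_above \<psi> k"
    using G_pos[of k] G_le_1[of k] variance_above_nonneg[OF _ \<phi>2] V.variance_above_nonneg[OF _ \<psi>2]
    by (intro add_mono mult_right_mono) (auto simp: power_le_one)
  finally show ?bound by simp
qed


text \<open>Adds the layer bounds from 0 to \<open>k\<close> by telescoping and lets
  \<open>k\<close> tend to infinity.\<close>

lemma cross_moment_bound:
  fixes \<phi> \<psi> :: "real \<Rightarrow> real" and t :: real
  assumes [measurable]: "\<phi> \<in> borel_measurable borel" "\<psi> \<in> borel_measurable borel"
    and \<phi>2: "integrable M (\<lambda>\<omega>. (\<phi> (U \<omega>))\<^sup>2)" and \<psi>2: "integrable M (\<lambda>\<omega>. (\<psi> (V \<omega>))\<^sup>2)" and "0 < t"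
  shows "2 * (expectation (\<lambda>\<omega>. \<phi> (U \<omega>) * \<psi> (V \<omega>)) - expectation (\<lambda>\<omega>. \<phi> (U \<omega>)) * expectation (\<lambda>\<omega>. \<psi> (V \<omega>)))
    \<le> R_minima (a + b + c) (a + c) a (G 1) * (t * variance (\<lambda>\<omega>. \<phi> (U \<omega>)) + variance (\<lambda>\<omega>. \<psi> (V \<omega>)) / t)"
proof -
  interpret V: overlapping_minima M V U G b a c by (rule swap)
  define \<rho> where "\<rho> = R_minima (a + b + c) (a + c) a (G 1)"
  define v w where "v = variance_above \<phi>" and "w = V.variance_above \<psi>"
  define d where "d k = expectation (\<lambda>\<omega>. \<phi> (U \<omega>) * \<psi> (V \<omega>) * (indicator {real k..} (U \<omega>) * indicator {real k..} (V \<omega>))) -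
    G k ^ (a + b + c) * mean_above \<phi> k * V.mean_above \<psi> k" for k
  have \<rho>: "0 \<le> \<rho>"
    using G_pos[of 1] G_1 c_pos by (subst \<rho>_def, subst R_minima_eq_sqrt) (auto simp: power_le_one)
  have nonneg: "0 \<le> v k" "0 \<le> w k" for k
    unfolding v_def w_def by (auto intro!: variance_above_nonneg V.variance_above_nonneg \<phi>2 \<psi>2)
  have step: "2 * (d k - d (Suc k)) \<le> \<rho> * (t * (v k - v (Suc k)) + (w k - w (Suc k)) / t)" for k
  proof -
    \<comment> \<open>The conditional survival probability at \<open>k\<close>, at most
      \<open>G 1\<close> by \<open>G_Suc_le\<close>.\<close>
    define g where "g = G (Suc k) / G k"
    have g: "0 < g" "g \<le> G 1" using G_pos[of k] G_pos[of "Suc k"] G_Suc_le[of k]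
      by (auto simp: g_def divide_simps)
    have G_Suc: "G (Suc k) = g * G k" using G_pos[of k] by (simp add: g_def)
    have lt: "g ^ j \<le> 1" for j using g G_1 by (intro power_le_one) auto
    have "G (Suc k) ^ (a + b + c) * (1 - g ^ c) \<le> \<rho> *
      sqrt ((G (Suc k) ^ (a + c) * (1 - g ^ (a + c))) * (G (Suc k) ^ (b + c) * (1 - g ^ (b + c))))"
      unfolding \<rho>_def G_Suc using g G_1 c_pos G_pos[of k] G_le_1[of k] by (intro R_minima_step) auto
    then show ?thesis
      unfolding d_def v_def w_def covariance_above_Suc(1)[OF assms(1,2) \<phi>2 \<psi>2]
        variance_above_Suc[OF assms(1) \<phi>2] V.variance_above_Suc[OF assms(2) \<psi>2] g_def[symmetric]
      using \<rho> lt \<open>0 < t\<close> G_pos[of "Suc k"] by (intro weighted_AM_GM) (auto intro!: mult_nonneg_nonneg)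
  qed
  have tele: "2 * (d 0 - d k) \<le> \<rho> * (t * (v 0 - v k) + (w 0 - w k) / t)" for k
  proof (induction k)
    case (Suc k)
    have "2 * (d 0 - d (Suc k)) = 2 * (d 0 - d k) + 2 * (d k - d (Suc k))" by simp
    also have "\<dots> \<le> \<rho> * (t * (v 0 - v k) + (w 0 - w k) / t) + \<rho> * (t * (v k - v (Suc k)) + (w k - w (Suc k)) / t)"
      by (intro add_mono Suc step)
    also have "\<dots> = \<rho> * (t * (v 0 - v (Suc k)) + (w 0 - w (Suc k)) / t)"
      by (simp add: algebra_simps diff_divide_distrib)
    finally show ?case .
  qed simp
  have "2 * d 0 \<le> (v k + w k) + \<rho> * (t * v 0 + w 0 / t)" for k
  proof -
    have "2 * d k \<le> v k + w k"
      unfolding d_def v_def w_def by (rule covariance_above_Suc(2)[OF assms(1,2) \<phi>2 \<psi>2])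
    moreover have "\<rho> * (t * (v 0 - v k) + (w 0 - w k) / t) \<le> \<rho> * (t * v 0 + w 0 / t)"
      using nonneg[of k] \<rho> \<open>0 < t\<close> by (intro mult_left_mono add_mono divide_right_mono) auto
    ultimately have "2 * (d 0 - d k) + 2 * d k \<le> \<rho> * (t * v 0 + w 0 / t) + (v k + w k)"
      using tele[of k] by (intro add_mono) (rule order_trans)
    then show ?thesis by simp
  qed
  moreover have "(\<lambda>k. (v k + w k) + \<rho> * (t * v 0 + w 0 / t)) \<longlonglongrightarrow> (0 + 0) + \<rho> * (t * v 0 + w 0 / t)"
    unfolding v_def w_def
    by (intro tendsto_add tendsto_const variance_above_tendsto_0 V.variance_above_tendsto_0 \<phi>2 \<psi>2 assms)
  ultimately have "2 * d 0 \<le> (0 + 0) + \<rho> * (t * v 0 + w 0 / t)"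
    by (intro LIMSEQ_le_const) auto
  moreover have "d 0 = expectation (\<lambda>\<omega>. \<phi> (U \<omega>) * \<psi> (V \<omega>)) - expectation (\<lambda>\<omega>. \<phi> (U \<omega>)) * expectation (\<lambda>\<omega>. \<psi> (V \<omega>))"
  proof -
    have "expectation (\<lambda>\<omega>. \<phi> (U \<omega>) * \<psi> (V \<omega>) * (indicator {real 0..} (U \<omega>) * indicator {real 0..} (V \<omega>))) =
        expectation (\<lambda>\<omega>. \<phi> (U \<omega>) * \<psi> (V \<omega>))"
    proof (rule integral_cong_AE)
      show "AE \<omega> in M. \<phi> (U \<omega>) * \<psi> (V \<omega>) * (indicator {real 0..} (U \<omega>) * indicator {real 0..} (V \<omega>)) =
          \<phi> (U \<omega>) * \<psi> (V \<omega>)"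
        using U_Nats V_Nats by eventually_elim (auto simp: Nats_def)
    qed measurable
    then show ?thesis
      by (simp add: d_def mean_above_0[OF _ \<phi>2] V.mean_above_0[OF _ \<psi>2] G_0)
  qed
  ultimately show ?thesis
    by (simp add: \<rho>_def v_def w_def variance_above_0[OF _ \<phi>2] V.variance_above_0[OF _ \<psi>2])
qed

section \<open>The maximal correlation of the abstract pair\<close>

lemma covariance_eq:
  fixes f g :: "'a \<Rightarrow> real"
  assumes "integrable M f" "integrable M g" "integrable M (\<lambda>\<omega>. f \<omega> * g \<omega>)"
  shows "covariance M f g = expectation (\<lambda>\<omega>. f \<omega> * g \<omega>) - expectation f * expectation g"
proof -
  have "covariance M f g = expectation (\<lambda>\<omega>. f \<omega> * g \<omega> - expectation g * f \<omega> - expectation f * g \<omega> + expectation f * expectation g)"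
    unfolding covariance_def by (intro Bochner_Integration.integral_cong) (auto simp: algebra_simps)
  also have "\<dots> = expectation (\<lambda>\<omega>. f \<omega> * g \<omega>) - expectation f * expectation g"
    using assms by (simp add: prob_space)
  finally show ?thesis .
qed

text \<open>The supremum is a maximum: the indicator of \<open>{1..}\<close>, used for both
  functions, attains the value, and \<open>cross_moment_bound\<close> shows that no pair exceeds
  it.\<close>

lemma maximal_correlation_eq: "maximal_correlation M U V = R_minima (a + b + c) (a + c) a (G 1)"
  unfolding maximal_correlation_def
proof (rule cSup_eq_maximum)
  define I :: "real \<Rightarrow> real" where "I = indicator {real 1..}"
  have I [measurable]: "I \<in> borel_measurable borel" by (simp add: I_def)
  have I2: "(I x)\<^sup>2 = I x" for x by (simp add: I_def indicator_def)
  have int: "integrable M (\<lambda>\<omega>. I (U \<omega>))" "integrable M (\<lambda>\<omega>. I (V \<omega>))" "integrable M (\<lambda>\<omega>. I (U \<omega>) * I (V \<omega>))"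
    by (rule integrable_const_bound[of _ 1]; auto simp: I_def indicator_def)+
  have EU: "expectation (\<lambda>\<omega>. I (U \<omega>)) = G 1 ^ (a + c)" and EV: "expectation (\<lambda>\<omega>. I (V \<omega>)) = G 1 ^ (b + c)"
    unfolding I_def by (rule U_tail V_tail)+
  have EUV: "expectation (\<lambda>\<omega>. I (U \<omega>) * I (V \<omega>)) = G 1 ^ (a + b + c)"
    using U_both[of "\<lambda>_. 1" 1, OF borel_measurable_const integrable_const]
    unfolding mult_1_left I_def U_tail by (simp add: power_add mult_ac)
  have varU: "variance (I \<circ> U) = G 1 ^ (a + c) * (1 - G 1 ^ (a + c))"
    using int unfolding comp_def by (subst variance_eq) (simp_all add: I2 EU, simp add: power2_eq_square algebra_simps)
  have varV: "variance (I \<circ> V) = G 1 ^ (b + c) * (1 - G 1 ^ (b + c))"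
    using int unfolding comp_def by (subst variance_eq) (simp_all add: I2 EV, simp add: power2_eq_square algebra_simps)
  have cov: "covariance M (I \<circ> U) (I \<circ> V) = G 1 ^ (a + b + c) - G 1 ^ (a + c) * G 1 ^ (b + c)"
    using int by (subst covariance_eq) (auto simp: EU EV EUV comp_def)
  have lt: "G 1 ^ (a + c) < 1" "G 1 ^ (b + c) < 1"
    using G_1 G_pos[of 1] c_pos by (auto intro!: power_less_one_iff[THEN iffD2])
  have "pos_finite_variance M (I \<circ> U)" "pos_finite_variance M (I \<circ> V)"
    unfolding pos_finite_variance_def varU varV using int lt G_pos[of 1] by (auto simp: I2)
  moreover have "R_minima (a + b + c) (a + c) a (G 1) =
      covariance M (I \<circ> U) (I \<circ> V) / sqrt (variance (I \<circ> U) * variance (I \<circ> V))"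
  proof -
    have "a + b + c - a = b + c" "a + c + (a + b + c) - a = a + c + (b + c)" by auto
    then show ?thesis unfolding R_minima_def cov varU varV by (simp add: power_add mult_ac)
  qed
  ultimately show "R_minima (a + b + c) (a + c) a (G 1) \<in> {covariance M (\<phi> \<circ> U) (\<psi> \<circ> V) /
      sqrt (variance (\<phi> \<circ> U) * variance (\<psi> \<circ> V)) | \<phi> \<psi>.
      \<phi> \<in> borel_measurable borel \<and> \<psi> \<in> borel_measurable borel \<and>
      pos_finite_variance M (\<phi> \<circ> U) \<and> pos_finite_variance M (\<psi> \<circ> V)}"
    using I by blast
next
  fix x assume "x \<in> {covariance M (\<phi> \<circ> U) (\<psi> \<circ> V) /
      sqrt (variance (\<phi> \<circ> U) * variance (\<psi> \<circ> V)) | \<phi> \<psi>.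
      \<phi> \<in> borel_measurable borel \<and> \<psi> \<in> borel_measurable borel \<and>
      pos_finite_variance M (\<phi> \<circ> U) \<and> pos_finite_variance M (\<psi> \<circ> V)}"
  then obtain \<phi> \<psi> where x: "x = covariance M (\<phi> \<circ> U) (\<psi> \<circ> V) / sqrt (variance (\<phi> \<circ> U) * variance (\<psi> \<circ> V))"
    and [measurable]: "\<phi> \<in> borel_measurable borel" "\<psi> \<in> borel_measurable borel"
    and pos: "pos_finite_variance M (\<phi> \<circ> U)" "pos_finite_variance M (\<psi> \<circ> V)"
    by blast
  define v w where "v = variance (\<phi> \<circ> U)" and "w = variance (\<psi> \<circ> V)"
  from pos have vw: "0 < v" "0 < w" and \<phi>2: "integrable M (\<lambda>\<omega>. (\<phi> (U \<omega>))\<^sup>2)" and \<psi>2: "integrable M (\<lambda>\<omega>. (\<psi> (V \<omega>))\<^sup>2)"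
    by (auto simp: pos_finite_variance_def v_def w_def)
  interpret V: overlapping_minima M V U G b a c by (rule swap)
  have cov: "covariance M (\<phi> \<circ> U) (\<psi> \<circ> V) =
      expectation (\<lambda>\<omega>. \<phi> (U \<omega>) * \<psi> (V \<omega>)) - expectation (\<lambda>\<omega>. \<phi> (U \<omega>)) * expectation (\<lambda>\<omega>. \<psi> (V \<omega>))"
    using integrable_f[OF _ \<phi>2] V.integrable_f[OF _ \<psi>2] \<phi>2 \<psi>2
    by (subst covariance_eq) (auto simp: comp_def intro!: integrable_mult_square_integrable)
  \<comment> \<open>This weight balances the two terms, turning the AM-GM bound into Cauchy-Schwarz.\<close>
  define t where "t = sqrt (w / v)"
  have "0 < t" using vw by (simp add: t_def)
  have "t * v = sqrt (v * w)" "w / t = sqrt (v * w)"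
    using vw by (auto simp: t_def real_sqrt_divide real_sqrt_mult divide_simps)
  then have "covariance M (\<phi> \<circ> U) (\<psi> \<circ> V) \<le> R_minima (a + b + c) (a + c) a (G 1) * sqrt (v * w)"
    using cross_moment_bound[OF _ _ \<phi>2 \<psi>2 \<open>0 < t\<close>] unfolding cov by (simp add: v_def w_def comp_def)
  then show "x \<le> R_minima (a + b + c) (a + c) a (G 1)"
    using vw unfolding x v_def[symmetric] w_def[symmetric] by (simp add: pos_divide_le_eq)
qed

end

section \<open>Independence and minima over index sets\<close>

context prob_space
begin

lemma expectation_indep_prod_indicator:
  fixes X :: "'i \<Rightarrow> 'a \<Rightarrow> real"
  assumes ind: "indep_vars (\<lambda>_. borel) X I" and fin: "finite I" and [measurable]: "S \<in> sets borel"
    and p: "\<And>i. i \<in> I \<Longrightarrow> measure (distr M borel (X i)) S = p"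
  shows "expectation (\<lambda>\<omega>. \<Prod>i\<in>I. indicator S (X i \<omega>) :: real) = p ^ card I"
proof -
  have [measurable]: "X i \<in> borel_measurable M" if "i \<in> I" for i
    using ind that by (auto simp: indep_vars_def2)
  have "expectation (\<lambda>\<omega>. indicator S (X i \<omega>) :: real) = p" if i: "i \<in> I" for i
    using integral_distr[of "X i" M borel "indicator S :: real \<Rightarrow> real"] i p[OF i] by simp
  moreover have "expectation (\<lambda>\<omega>. \<Prod>i\<in>I. indicator S (X i \<omega>) :: real) = (\<Prod>i\<in>I. expectation (\<lambda>\<omega>. indicator S (X i \<omega>)))"
  proof (rule indep_vars_lebesgue_integral[OF fin])
    show "indep_vars (\<lambda>_. borel) (\<lambda>i \<omega>. indicator S (X i \<omega>) :: real) I"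
      using ind by (rule indep_vars_compose2) measurable
    show "integrable M (\<lambda>\<omega>. indicator S (X i \<omega>) :: real)" if "i \<in> I" for i
      using that by (intro integrable_const_bound[of _ 1]) auto
  qed
  ultimately show ?thesis by simp
qed

text \<open>Functions of the variables over disjoint index sets are independent, so the expectation
  factors.\<close>

lemma expectation_indep_Min:
  fixes X :: "'i \<Rightarrow> 'a \<Rightarrow> real" and f :: "real \<Rightarrow> real"
  assumes ind: "indep_vars (\<lambda>_. borel) X I" and AB: "A \<inter> B = {}" "A \<subseteq> I" "B \<subseteq> I" "A \<noteq> {}" "finite I"
    and [measurable]: "S \<in> sets borel" "f \<in> borel_measurable borel"
    and p: "\<And>i. i \<in> I \<Longrightarrow> measure (distr M borel (X i)) S = p"
    and int: "integrable M (\<lambda>\<omega>. f (MIN i\<in>A. X i \<omega>))"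
  shows "expectation (\<lambda>\<omega>. f (MIN i\<in>A. X i \<omega>) * (\<Prod>i\<in>B. indicator S (X i \<omega>))) =
    p ^ card B * expectation (\<lambda>\<omega>. f (MIN i\<in>A. X i \<omega>))"
proof -
  have fin [simp]: "finite A" "finite B" using AB by (auto intro: finite_subset)
  have [measurable]: "X i \<in> borel_measurable M" if "i \<in> I" for i
    using ind that by (auto simp: indep_vars_def2)
  have X_meas: "X i \<in> borel_measurable M" if "i \<in> A \<or> i \<in> B" for i
    using that AB by auto
  define F where "F x = f (MIN i\<in>A. x i)" for x :: "'i \<Rightarrow> real"
  define H where "H x = (\<Prod>i\<in>B. indicator S (x i) :: real)" for x :: "'i \<Rightarrow> real"
  have F: "F \<in> borel_measurable (PiM A (\<lambda>_. borel))" unfolding F_def by measurable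
  have H: "H \<in> borel_measurable (PiM B (\<lambda>_. borel))" unfolding H_def by measurable
  \<comment> \<open>\<open>indep_var_restrict\<close> speaks of tuples restricted to
    \<open>A\<close> and \<open>B\<close>; this removes the restriction.\<close>
  have "(MIN i\<in>A. restrict x A i) = (MIN i\<in>A. x i)" for x :: "'i \<Rightarrow> real"
    by (rule arg_cong[of _ _ Min]) auto
  then have F_eq: "F (restrict x A) = f (MIN i\<in>A. x i)" for x by (simp add: F_def)
  have H_eq: "H (restrict x B) = (\<Prod>i\<in>B. indicator S (x i))" for x
    by (auto simp: H_def intro: prod.cong)
  have "indep_var borel (\<lambda>\<omega>. f (MIN i\<in>A. X i \<omega>)) borel (\<lambda>\<omega>. \<Prod>i\<in>B. indicator S (X i \<omega>))"
    using indep_var_compose[OF indep_var_restrict[OF ind AB(1-3)] F H]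
    by (simp add: comp_def F_eq H_eq)
  moreover have "integrable M (\<lambda>\<omega>. \<Prod>i\<in>B. indicator S (X i \<omega>) :: real)"
  proof (rule integrable_const_bound[of _ 1])
    show "AE \<omega> in M. norm (\<Prod>i\<in>B. indicator S (X i \<omega>) :: real) \<le> 1"
      by (intro AE_I2) (simp add: abs_prod prod_le_1)
    show "(\<lambda>\<omega>. \<Prod>i\<in>B. indicator S (X i \<omega>) :: real) \<in> borel_measurable M"
      using AB by (intro borel_measurable_prod) auto
  qed
  moreover have "expectation (\<lambda>\<omega>. \<Prod>i\<in>B. indicator S (X i \<omega>)) = p ^ card B"
    using AB p by (intro expectation_indep_prod_indicator indep_vars_subset[OF ind]) auto
  ultimately show ?thesis
    using int by (subst indep_var_lebesgue_integral) simp_all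
qed

end

lemma prod_indicator_atLeast:
  fixes x :: "'i \<Rightarrow> real"
  assumes "finite A"
  shows "(\<Prod>i\<in>A. indicator {k..} (x i) :: real) = of_bool (\<forall>i\<in>A. k \<le> x i)"
  using assms by (induction A rule: finite_induct) (auto simp: indicator_def)

lemma indicator_atLeast_Min:
  fixes x :: "'i \<Rightarrow> real"
  assumes "finite A" "A \<noteq> {}"
  shows "(indicator {k..} (MIN i\<in>A. x i) :: real) = (\<Prod>i\<in>A. indicator {k..} (x i))"
  using assms by (simp add: prod_indicator_atLeast indicator_def)

text \<open>Once the minimum over \<open>A\<close> is at least \<open>k\<close>, the minimum over
  \<open>B\<close> constrains only the indices in \<open>B - A\<close>. The remaining product then
  involves no variable from \<open>A\<close>.\<close>

lemma indicator_atLeast_Min_both: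
  fixes x :: "'i \<Rightarrow> real"
  assumes "finite A" "A \<noteq> {}" "finite B" "B \<noteq> {}"
  shows "(indicator {k..} (MIN i\<in>A. x i) * indicator {k..} (MIN i\<in>B. x i) :: real) =
    indicator {k..} (MIN i\<in>A. x i) * (\<Prod>i\<in>B - A. indicator {k..} (x i))"
  using assms by (auto simp: prod_indicator_atLeast indicator_def)

section \<open>The Poisson case\<close>

lemma poisson_distribution_atLeast:
  "measure (poisson_distribution lam) {real k..} = measure_pmf.prob (poisson_pmf lam) {k..}"
proof -
  have "real -` {real k..} = {k..}" by auto
  then show ?thesis by (simp add: poisson_distribution_def measure_distr)
qed

lemma AE_Nats_of_poisson:
  assumes "X \<in> borel_measurable M" and D: "distr M borel X = poisson_distribution lam"
  shows "AE \<omega> in M. X \<omega> \<in> \<nat>"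
proof -
  have [measurable]: "(\<nat> :: real set) \<in> sets borel"
    by (rule sets.countable) (auto simp: Nats_def)
  have "AE x in poisson_distribution lam. x \<in> \<nat>"
    unfolding poisson_distribution_def by (subst AE_distr_iff) auto
  then have "AE x in distr M borel X. x \<in> \<nat>" by (simp only: D)
  then show ?thesis using assms by (subst (asm) AE_distr_iff) auto
qed

theorem theorem1p6:
  fixes M :: "'a measure" and X :: "nat \<Rightarrow> 'a \<Rightarrow> real"
    and n m l :: nat and lam :: real
  assumes "prob_space M"
    and "1 \<le> l + 1" and "l + 1 \<le> m" and "m \<le> n"
    and "0 < lam"
    and "prob_space.indep_vars M (\<lambda>_. borel) X {1..n}"
    and "\<And>i. i \<in> {1..n} \<Longrightarrow> distr M borel (X i) = poisson_distribution lam"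
  shows "maximal_correlation M (\<lambda>\<omega>. MIN i\<in>{1..m}. X i \<omega>) (\<lambda>\<omega>. MIN j\<in>{l+1..n}. X j \<omega>)
           = R_minima n m l (1 - exp (- lam))"
proof -
  interpret prob_space M by fact
  note ind = assms(6)
  define G where "G k = measure_pmf.prob (poisson_pmf lam) {k..}" for k
  have G: "measure (distr M borel (X i)) {real k..} = G k" if "i \<in> {1..n}" for i k
    using assms(7)[OF that] by (simp add: G_def poisson_distribution_atLeast)
  have X_meas: "X i \<in> borel_measurable M" if "i \<in> {1..n}" for i
    using ind that by (auto simp: indep_vars_def2)
  have Min_meas: "(\<lambda>\<omega>. MIN i\<in>A. X i \<omega>) \<in> borel_measurable M" if "A \<subseteq> {1..n}" for A
    using that X_meas by (intro borel_measurable_Min) (auto intro: finite_subset)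
  have Min_Nats: "AE \<omega> in M. (MIN i\<in>A. X i \<omega>) \<in> \<nat>" if A: "A \<subseteq> {1..n}" "A \<noteq> {}" for A
  proof -
    have fin: "finite A" using A by (auto intro: finite_subset)
    have "AE \<omega> in M. \<forall>i\<in>A. X i \<omega> \<in> \<nat>"
      using fin A by (intro AE_finite_allI AE_Nats_of_poisson[of _ _ lam] X_meas assms(7)) auto
    then show ?thesis
    proof eventually_elim
      case (elim \<omega>)
      have "(MIN i\<in>A. X i \<omega>) \<in> (\<lambda>i. X i \<omega>) ` A" using fin A by (intro Min_in) auto
      then show ?case using elim by auto
    qed
  qed
  have Min_tail: "expectation (\<lambda>\<omega>. indicator {real k..} (MIN i\<in>A. X i \<omega>)) = G k ^ card A"
    if A: "A \<subseteq> {1..n}" "A \<noteq> {}" for A k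
  proof -
    have fin: "finite A" using A by (auto intro: finite_subset)
    have "expectation (\<lambda>\<omega>. \<Prod>i\<in>A. indicator {real k..} (X i \<omega>)) = G k ^ card A"
      using A fin G by (intro expectation_indep_prod_indicator indep_vars_subset[OF ind]) auto
    then show ?thesis using fin A by (simp add: indicator_atLeast_Min)
  qed
  have Min_both: "expectation (\<lambda>\<omega>. f (MIN i\<in>A. X i \<omega>) *
      (indicator {real k..} (MIN i\<in>A. X i \<omega>) * indicator {real k..} (MIN i\<in>B. X i \<omega>))) =
      G k ^ card (B - A) * expectation (\<lambda>\<omega>. f (MIN i\<in>A. X i \<omega>) * indicator {real k..} (MIN i\<in>A. X i \<omega>))"
    if A: "A \<subseteq> {1..n}" "A \<noteq> {}" and B: "B \<subseteq> {1..n}" "B \<noteq> {}"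
      and f: "f \<in> borel_measurable borel" and int: "integrable M (\<lambda>\<omega>. f (MIN i\<in>A. X i \<omega>))"
    for A B k and f :: "real \<Rightarrow> real"
  proof -
    have fin: "finite A" "finite B" using A B by (auto intro: finite_subset)
    have [measurable]: "(\<lambda>\<omega>. MIN i\<in>A. X i \<omega>) \<in> borel_measurable M" by (rule Min_meas[OF A(1)])
    have "integrable M (\<lambda>\<omega>. f (MIN i\<in>A. X i \<omega>) * indicator {real k..} (MIN i\<in>A. X i \<omega>))"
      using int by (rule integrable_mult_bounded) auto
    moreover have "A \<inter> (B - A) = {}" "B - A \<subseteq> {1..n}" using B by auto
    moreover have "(\<lambda>x. f x * indicator {real k..} x) \<in> borel_measurable borel" using f by measurable
    \<comment> \<open>The indicator of the minimum over \<open>A\<close> is absorbed into the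
      function of that minimum, leaving a product over the disjoint set
      \<open>B - A\<close>.\<close>
    ultimately have "expectation (\<lambda>\<omega>. f (MIN i\<in>A. X i \<omega>) * indicator {real k..} (MIN i\<in>A. X i \<omega>) *
        (\<Prod>i\<in>B - A. indicator {real k..} (X i \<omega>))) =
      G k ^ card (B - A) * expectation (\<lambda>\<omega>. f (MIN i\<in>A. X i \<omega>) * indicator {real k..} (MIN i\<in>A. X i \<omega>))"
      using A G expectation_indep_Min[OF ind, of A "B - A" "{real k..}" "\<lambda>x. f x * indicator {real k..} x" "G k"]
      by simp
    then show ?thesis
      unfolding indicator_atLeast_Min_both[OF fin(1) A(2) fin(2) B(2)] by (simp only: mult.assoc)
  qed
  let ?A = "{1..m}" and ?B = "{l + 1..n}"
  have sub: "?A \<subseteq> {1..n}" "?B \<subseteq> {1..n}" "?A \<noteq> {}" "?B \<noteq> {}" using assms by auto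
  \<comment> \<open>These are the private indices of the second and of the first minimum; the
    \<open>m - l\<close> indices from \<open>l + 1\<close> to \<open>m\<close> are shared.\<close>
  have "?B - ?A = {m + 1..n}" "?A - ?B = {1..l}" using assms by auto
  then have card: "card (?B - ?A) = n - m" "card (?A - ?B) = l" "card ?A = l + (m - l)" "card ?B = n - m + (m - l)"
    using assms by auto
  have q: "G 1 = 1 - exp (- lam)" using poisson_tail_1[OF \<open>0 < lam\<close>] by (simp add: G_def)
  interpret overlapping_minima M "\<lambda>\<omega>. MIN i\<in>?A. X i \<omega>" "\<lambda>\<omega>. MIN j\<in>?B. X j \<omega>" G l "n - m" "m - l"
  proof
    show "G 0 = 1" by (simp only: G_def poisson_tail_0)
    show "G 1 < 1" "0 < m - l" using q assms by auto
    show "0 < G k" "G (Suc k) \<le> G 1 * G k" for k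
      unfolding q using poisson_tail_pos[OF \<open>0 < lam\<close>] poisson_tail_Suc_le[OF \<open>0 < lam\<close>] by (auto simp: G_def)
    \<comment> \<open>\<open>Min_both\<close> with the two index sets exchanged, which also reverses
      the order of the indicators.\<close>
    show "expectation (\<lambda>\<omega>. f (MIN j\<in>?B. X j \<omega>) *
        (indicator {real k..} (MIN i\<in>?A. X i \<omega>) * indicator {real k..} (MIN j\<in>?B. X j \<omega>))) =
        G k ^ l * expectation (\<lambda>\<omega>. f (MIN j\<in>?B. X j \<omega>) * indicator {real k..} (MIN j\<in>?B. X j \<omega>))"
      if "f \<in> borel_measurable borel" "integrable M (\<lambda>\<omega>. f (MIN j\<in>?B. X j \<omega>))" for f :: "real \<Rightarrow> real" and k
      using Min_both[OF sub(2,4,1,3) that, of k] unfolding card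
      by (simp only: mult_ac)
  qed (use Min_meas Min_Nats Min_tail Min_both[OF sub(1,3,2,4)] sub card in auto)
  have "l + (n - m) + (m - l) = n" "l + (m - l) = m" using assms by auto
  then show ?thesis using maximal_correlation_eq by (simp only: q)
qed

end
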